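(* Let $1\le p<+\infty$. There exist positive constants $R_p$ and $\tilde R_p$ (depending only on $p$) such that for every $f\in L^p[0,\pi]$ and every $n\in\{1,2,\dots\}$, \[ \|\mathcal{D}_n(f)-f\|_p\le R_p\,K_p\big(f,\tilde R_p\,m_n\big), \] where $\mathcal{D}_n$ is the $n$-th Gr\"unwald--Durrmeyer operator and \[ m_n=\begin{cases}\dfrac{1+\log n}{n}, & p=1,\\[8pt] \dfrac{1+\log n}{n}+\dfrac{1}{n^{1/p}}, & 1<p<+\infty.\end{cases} \]
   Context: For $n=1,2,\dots$ and $k=1,\dots,n$ let $\theta_k^{(n)}=\frac{2k-1}{2n}\pi$ and \[ P_k(t)=(-1)^{k+1}\frac{\cos(nt)\,\sin\theta_k^{(n)}}{n\,(\cos t-\cos\theta_k^{(n)})},\qquad t\in\mathbb{R}, \] where the (removable) singularities are filled in by continuity ($P_k$ depends on $n$ as well). Put \[ S_{k,n}(t)=\tfrac12\left(P_k\!\left(t-\tfrac{\pi}{2n}\right)+P_k\!\left(t+\tfrac{\pi}{2n}\right)\right). \] The $n$-th Gr\"unwald--Durrmeyer operator is defined, for $f\in L^p[0,\pi]$ ($1\le p\le+\infty$, Lebesgue measure) and $\theta\in[0,\pi]$, by \[ \mathcal{D}_n(f)(\theta)=\frac{n}{\pi}\sum_{k=1}^n S_{k,n}(\theta)\int_0^\pi f(t)\,S_{k,n}(t)\,dt . \] For $1\le p<+\infty$, $f\in L^p[0,\pi]$ and $\delta>0$, the $K$-functional is \[ K_p(f,\delta)=\inf_{g\in C^1[0,\pi]}\left\{\|f-g\|_p+\delta\,\|g'\|_\infty\right\},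 \] where $C^1[0,\pi]$ is the space of continuously differentiable functions on $[0,\pi]$, $\|\cdot\|_p$ is the $L^p[0,\pi]$ norm and $\|\cdot\|_\infty$ the supremum norm. *)

theory Defs
  imports "HOL-Analysis.Analysis"
begin

definition node :: "nat \<Rightarrow> nat \<Rightarrow> real" where
  "node n k = (2 * real k - 1) / (2 * real n) * pi"

definition fund_quot :: "nat \<Rightarrow> nat \<Rightarrow> real \<Rightarrow> real" where
  "fund_quot n k t =
     (- 1) ^ (k + 1) * (cos (real n * t) * sin (node n k))
       / (real n * (cos t - cos (node n k)))"

(* The zeros of the denominator are removable singularities for 1 <= k <= n: there
   the value is the limit over the punctured neighbourhood, not Isabelle's x / 0 = 0. *)
definition fund_P :: "nat \<Rightarrow> nat \<Rightarrow> real \<Rightarrow> real" where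
  "fund_P n k t =
     (if cos t \<noteq> cos (node n k) then fund_quot n k t
      else Lim (at t) (fund_quot n k))"

definition fund_S :: "nat \<Rightarrow> nat \<Rightarrow> real \<Rightarrow> real" where
  "fund_S n k t =
     1 / 2 * (fund_P n k (t - pi / (2 * real n)) + fund_P n k (t + pi / (2 * real n)))"

abbreviation leb_0pi :: "real measure" where
  "leb_0pi \<equiv> lebesgue_on {0..pi}"

definition grunwald_durrmeyer :: "nat \<Rightarrow> (real \<Rightarrow> real) \<Rightarrow> real \<Rightarrow> real" where
  "grunwald_durrmeyer n f \<theta> =
     real n / pi * (\<Sum>k = 1..n. fund_S n k \<theta> * (LINT t|leb_0pi. f t * fund_S n k t))"

(* L^p[0,pi] for finite p; elements are represented by total functions whose values
   outside [0,pi] play no role. *)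
definition Lp_0pi :: "real \<Rightarrow> (real \<Rightarrow> real) set" where
  "Lp_0pi p = {f \<in> borel_measurable leb_0pi. integrable leb_0pi (\<lambda>t. \<bar>f t\<bar> powr p)}"

definition Lp_norm :: "real \<Rightarrow> (real \<Rightarrow> real) \<Rightarrow> real" where
  "Lp_norm p f = (LINT t|leb_0pi. \<bar>f t\<bar> powr p) powr (1 / p)"

definition sup_norm_0pi :: "(real \<Rightarrow> real) \<Rightarrow> real" where
  "sup_norm_0pi f = (SUP t\<in>{0..pi}. \<bar>f t\<bar>)"

(* g is in C^1[0,pi] with derivative g'; the derivative is one-sided at 0 and pi, unlike
   in C1_differentiable_on, which takes two-sided derivatives at the endpoints. *)
definition C1_0pi_deriv :: "(real \<Rightarrow> real) \<Rightarrow> (real \<Rightarrow> real) \<Rightarrow> bool" where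
  "C1_0pi_deriv g g' \<longleftrightarrow>
     (\<forall>t\<in>{0..pi}. (g has_real_derivative g' t) (at t within {0..pi}))
     \<and> continuous_on {0..pi} g'"

definition K_functional :: "real \<Rightarrow> (real \<Rightarrow> real) \<Rightarrow> real \<Rightarrow> real" where
  "K_functional p f \<delta> =
     Inf {Lp_norm p (\<lambda>t. f t - g t) + \<delta> * sup_norm_0pi g' | g g'. C1_0pi_deriv g g'}"

definition rate_m :: "real \<Rightarrow> nat \<Rightarrow> real" where
  "rate_m p n =
     (if p = 1 then (1 + ln (real n)) / real n
      else (1 + ln (real n)) / real n + 1 / real n powr (1 / p))"

end

theory Submission
  imports Defs
begin

text \<open>
  Writing \<open>h = pi / (2 n)\<close>, the Christoffel--Darboux identity turns \<open>P_k\<close> and hence \<open>S_k\<close> into cosine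
  polynomials; this gives \<open>\<bar>S_k\<bar> \<le> 2\<close>, \<open>\<integral> S_k = pi / n\<close> and \<open>\<Sum>k. S_k = 1\<close>, so that the operator reproduces
  constants. Averaging over \<open>\<plusminus> h\<close> cancels the leading term of \<open>P_k\<close>, and \<open>S_k\<close> decays quadratically:
  \<open>S_k(t)\<close> is of order \<open>1 / (1 + (n (t - \<theta>_k))^2)\<close>. Consequently \<open>\<Sum>k. \<bar>S_k\<bar>\<close> and \<open>n \<integral> \<bar>S_k\<bar>\<close> are bounded,
  and with the additional weight \<open>\<bar>t - \<theta>_k\<bar>\<close> both are of order \<open>(1 + ln n) / n\<close>. The unweighted bounds give
  uniform boundedness on \<open>L^p\<close>; the weighted ones give the error \<open>(1 + ln n) / n\<close>, uniformly on \<open>[0, pi]\<close>,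
  for a Lipschitz function. Splitting \<open>f = (f - g) + g\<close> then yields the estimate by the K-functional,
  where only the first summand of the rate is used.
\<close>

section \<open>Cosine polynomials for \<open>fund_P\<close> and \<open>fund_S\<close>\<close>

text \<open>Christoffel-Darboux formula for the Chebyshev polynomials in the variable
  \<open>cos t\<close>. By the three-term recurrence \<open>rec\<close>, adding the next summand,
  multiplied by \<open>cos t - cos x\<close>, turns the right-hand side for \<open>m\<close> into
  that for \<open>Suc m\<close>.\<close>

lemma cos_christoffel_darboux:
  fixes t x :: real
  shows "(cos t - cos x) * (1 + 2 * (\<Sum>j=1..<Suc m. cos (real j * x) * cos (real j * t)))
    = cos (real (Suc m) * t) * cos (real m * x) - cos (real m * t) * cos (real (Suc m) * x)"
proof (induction m)
  case (Suc m)
  have rec: "2 * cos y * cos (real (Suc m) * y) = cos (real (Suc (Suc m)) * y) + cos (real m * y)"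
    for y :: real
  proof -
    have "real (Suc (Suc m)) * y = real (Suc m) * y + y" "real m * y = real (Suc m) * y - y"
      by (simp_all add: algebra_simps)
    then show ?thesis
      by (simp only: cos_add cos_diff) (simp add: algebra_simps)
  qed
  have "(cos t - cos x) * (1 + 2 * (\<Sum>j=1..<Suc (Suc m). cos (real j * x) * cos (real j * t)))
    = (cos t - cos x) * (1 + 2 * (\<Sum>j=1..<Suc m. cos (real j * x) * cos (real j * t)))
      + (2 * cos t * cos (real (Suc m) * t)) * cos (real (Suc m) * x)
      - (2 * cos x * cos (real (Suc m) * x)) * cos (real (Suc m) * t)"
    by (simp add: algebra_simps)
  also have "\<dots> = cos (real (Suc (Suc m)) * t) * cos (real (Suc m) * x)
      - cos (real (Suc m) * t) * cos (real (Suc (Suc m)) * x)"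
    unfolding Suc.IH rec by (simp add: algebra_simps)
  finally show ?case .
qed simp

context
  fixes n k :: nat
  assumes n: "1 \<le> n" and k: "k \<in> {1..n}"
begin

lemma node_bounds: "pi / (2 * real n) \<le> node n k" "node n k \<le> pi - pi / (2 * real n)"
proof -
  have "1 * pi \<le> (2 * real k - 1) * pi" "(2 * real k - 1) * pi \<le> (2 * real n - 1) * pi"
    using k by (auto intro!: mult_right_mono)
  then show "pi / (2 * real n) \<le> node n k" "node n k \<le> pi - pi / (2 * real n)"
    using n by (auto simp: node_def field_simps)
qed

lemma node_in: "0 < node n k" "node n k < pi"
proof -
  have "0 < pi / (2 * real n)"
    using n by simp
  then show "0 < node n k" "node n k < pi"
    using node_bounds by linarith+
qed

lemma sin_node_pos: "0 < sin (node n k)"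
  using node_in by (rule sin_gt_zero)

text \<open>The identity is multiplied out so that it also covers the points with
  \<open>cos t = cos (node n k)\<close>. For the node \<open>x\<close>,
  \<open>n x = (k - 1) pi + pi / 2\<close>. Hence \<open>cos (n x) = 0\<close> removes one
  Christoffel-Darboux term, and \<open>cos ((n - 1) x) = sin (n x) sin x\<close> supplies sign and
  sine in the other.\<close>

lemma fund_quot_cosine_sum:
  "real n * (cos t - cos (node n k))
      * (1 / real n * (1 + 2 * (\<Sum>j=1..<n. cos (real j * node n k) * cos (real j * t))))
    = (- 1) ^ (k + 1) * (cos (real n * t) * sin (node n k))"
proof -
  obtain m where m: "n = Suc m"
    using n by (cases n) auto
  obtain i where i: "k = Suc i"
    using k by (cases k) auto
  have e: "real n * node n k = real i * pi + pi / 2"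
    using n by (simp add: node_def i field_simps)
  have cos0: "cos (real n * node n k) = 0"
    unfolding e by (simp add: cos_add)
  have sin1: "sin (real n * node n k) = (- 1) ^ (k + 1)"
    unfolding e by (simp add: sin_add i)
  have "real m * node n k = real n * node n k - node n k"
    by (simp add: m algebra_simps)
  then have "cos (real m * node n k) = (- 1) ^ (k + 1) * sin (node n k)"
    using cos0 sin1 by (simp add: cos_diff)
  with cos_christoffel_darboux[of t "node n k" m] cos0 show ?thesis
    using n by (simp add: m[symmetric])
qed

text \<open>The cosine sum is continuous and agrees with the quotient off the singularities, so it
  is also the limit that \<open>fund_P\<close> takes there.\<close>

lemma fund_P_cosine_sum:
  "fund_P n k t = 1 / real n * (1 + 2 * (\<Sum>j=1..<n. cos (real j * node n k) * cos (real j * t)))"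
proof -
  define T where
    "T s = 1 / real n * (1 + 2 * (\<Sum>j=1..<n. cos (real j * node n k) * cos (real j * s)))" for s
  have eq: "fund_quot n k s = T s" if "cos s \<noteq> cos (node n k)" for s
    using fund_quot_cosine_sum[of s, folded T_def] n that
    unfolding fund_quot_def by (simp add: divide_simps mult.commute)
  have "fund_P n k t = T t"
  proof (cases "cos t = cos (node n k)")
    case True
    have "(sin t)\<^sup>2 = (sin (node n k))\<^sup>2"
      by (simp add: sin_squared_eq True)
    then have sint: "sin t \<noteq> 0"
      using sin_node_pos by auto
    \<comment> \<open>The derivative \<open>- sin t\<close> is nonzero, so the zero of the
      denominator at \<open>t\<close> is isolated and the quotient formula holds on a punctured
      neighbourhood.\<close>
    have "((\<lambda>s. (cos s - cos t) / (s - t)) \<longlongrightarrow> - sin t) (at t)"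
      using DERIV_cos[of t] by (simp add: has_field_derivative_iff)
    from tendsto_imp_eventually_ne[OF this, of 0] sint
    have "\<forall>\<^sub>F s in at t. (cos s - cos t) / (s - t) \<noteq> 0"
      by simp
    then have ev: "\<forall>\<^sub>F s in at t. T s = fund_quot n k s"
      by eventually_elim (metis True diff_self div_0 eq)
    have "isCont T t"
      unfolding T_def by (intro continuous_intros)
    then have "(T \<longlongrightarrow> T t) (at t)"
      by (simp add: isCont_def)
    then have "(fund_quot n k \<longlongrightarrow> T t) (at t)"
      by (rule Lim_transform_eventually[OF _ ev])
    then have "Lim (at t) (fund_quot n k) = T t"
      by (intro tendsto_Lim) auto
    then show ?thesis
      by (simp add: fund_P_def True)
  qed (simp add: fund_P_def eq)
  then show ?thesis
    by (simp add: T_def)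
qed

text \<open>Averaging over the two shifts multiplies the coefficient of frequency \<open>j\<close>
  by \<open>cos (j h)\<close>, where \<open>h = pi / (2 n)\<close>.\<close>

lemma fund_S_cosine_sum:
  "fund_S n k t = 1 / real n * (1 + 2 * (\<Sum>j=1..<n.
     cos (real j * (pi / (2 * real n))) * cos (real j * node n k) * cos (real j * t)))"
proof -
  have *: "1 / 2 * (1 / N * (1 + 2 * A) + 1 / N * (1 + 2 * B)) = 1 / N * (1 + 2 * C)"
    if "A + B = 2 * C" for A B C N :: real
  proof -
    have "1 / 2 * (1 / N * (1 + 2 * A) + 1 / N * (1 + 2 * B)) = 1 / N * (1 + (A + B))"
      by (simp add: algebra_simps add_divide_distrib)
    then show ?thesis
      unfolding that .
  qed
  show ?thesis
    unfolding fund_S_def fund_P_cosine_sum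
    by (rule *) (simp add: sum.distrib[symmetric] sum_distrib_left distrib_left right_diff_distrib
        cos_add cos_diff algebra_simps)
qed

lemma abs_fund_S_le_2: "\<bar>fund_S n k t\<bar> \<le> 2"
proof -
  have "\<bar>\<Sum>j=1..<n. cos (real j * (pi / (2 * real n))) * cos (real j * node n k) * cos (real j * t)\<bar>
      \<le> (\<Sum>j=1..<n. 1)"
    by (intro order_trans[OF sum_abs] sum_mono) (simp add: abs_mult mult_le_one)
  then show ?thesis
    unfolding fund_S_cosine_sum using n by (simp add: abs_mult field_simps of_nat_diff)
qed

lemma continuous_on_fund_S: "continuous_on A (fund_S n k)"
  unfolding fund_S_cosine_sum[abs_def] by (intro continuous_intros)

text \<open>Only the constant term contributes, since \<open>sin (j t) / j\<close> vanishes at both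
  endpoints.\<close>

lemma integral_fund_S: "(LINT t|leb_0pi. fund_S n k t) = pi / real n"
proof -
  define F where "F t = 1 / real n * (t + 2 * (\<Sum>j=1..<n.
    cos (real j * (pi / (2 * real n))) * cos (real j * node n k) * (sin (real j * t) / real j)))" for t
  have "(F has_vector_derivative fund_S n k t) (at t within {0..pi})" for t
    unfolding F_def fund_S_cosine_sum has_real_derivative_iff_has_vector_derivative[symmetric]
    using n by (auto intro!: derivative_eq_intros sum.cong simp: mult_ac)
  then have "(fund_S n k has_integral (F pi - F 0)) {0..pi}"
    by (intro fundamental_theorem_of_calculus) auto
  moreover have "F pi - F 0 = pi / real n"
    by (simp add: F_def)
  moreover have "integrable leb_0pi (fund_S n k)"
    by (intro continuous_imp_integrable_real continuous_on_fund_S)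
  ultimately show ?thesis
    by (simp add: lebesgue_integral_eq_integral integral_unique)
qed

end

text \<open>Each frequency \<open>0 < j < n\<close> cancels over the nodes: after multiplication by
  \<open>2 sin a\<close>, \<open>a = j pi / (2 n)\<close>, the sum over \<open>k\<close> telescopes
  to \<open>sin (2 a n) = sin (j pi) = 0\<close>.\<close>

lemma sum_fund_S:
  assumes n: "1 \<le> n"
  shows "(\<Sum>k=1..n. fund_S n k t) = 1"
proof -
  have zero: "(\<Sum>k=1..n. cos (real j * node n k)) = 0" if j: "j \<in> {1..<n}" for j
  proof -
    define a where "a = real j * (pi / (2 * real n))"
    have "0 < a" "a < pi"
      using j n by (auto simp: a_def field_simps)
    then have "0 < sin a"
      by (rule sin_gt_zero)
    have "2 * sin a * cos (real j * node n k) = sin (2 * a * real k) - sin (2 * a * (real k - 1))" for k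
    proof -
      have "real j * node n k = 2 * a * real k - a"
        using n by (simp add: node_def a_def field_simps)
      then have "2 * a * real k = real j * node n k + a" "2 * a * (real k - 1) = real j * node n k - a"
        by (simp_all add: algebra_simps)
      then show ?thesis
        by (simp only: sin_add sin_diff) simp
    qed
    then have "2 * sin a * (\<Sum>k=1..m. cos (real j * node n k)) = sin (2 * a * real m)" for m
      by (induction m) (simp_all add: distrib_left)
    from this[of n] have "2 * sin a * (\<Sum>k=1..n. cos (real j * node n k)) = 0"
      using n by (simp add: a_def)
    with \<open>0 < sin a\<close> show ?thesis
      by simp
  qed
  have "(\<Sum>k=1..n. fund_S n k t) = (\<Sum>k=1..n. 1 / real n * (1 + 2 * (\<Sum>j=1..<n.
     cos (real j * (pi / (2 * real n))) * cos (real j * node n k) * cos (real j * t))))"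
    by (intro sum.cong refl fund_S_cosine_sum n)
  also have "\<dots> = 1 / real n * (real n + 2 * (\<Sum>k=1..n. \<Sum>j=1..<n.
     cos (real j * (pi / (2 * real n))) * cos (real j * node n k) * cos (real j * t)))"
    by (simp add: sum_distrib_left[symmetric] sum.distrib sum_divide_distrib[symmetric])
  also have "(\<Sum>k=1..n. \<Sum>j=1..<n.
      cos (real j * (pi / (2 * real n))) * cos (real j * node n k) * cos (real j * t))
    = (\<Sum>j=1..<n. cos (real j * (pi / (2 * real n))) * cos (real j * t) *
        (\<Sum>k=1..n. cos (real j * node n k)))"
    by (subst sum.swap) (simp add: sum_distrib_left mult_ac)
  also have "\<dots> = 0"
    using zero by simp
  finally show ?thesis
    using n by simp
qed

section \<open>Quadratic decay of \<open>fund_S\<close> away from the node\<close>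

text \<open>Jordan's inequality by concavity: the mean slope of the sine on \<open>[0, v]\<close> is
  at least that on \<open>[v, pi / 2]\<close>, because the cosine decreases between the two mean
  value points.\<close>

lemma sin_ge_chord:
  fixes v :: real
  assumes "0 \<le> v" "v \<le> pi / 2"
  shows "2 * v \<le> pi * sin v"
proof -
  consider "v = 0" | "v = pi / 2" | "0 < v" "v < pi / 2"
    using assms by linarith
  then show ?thesis
  proof cases
    case 3
    obtain x where x: "0 < x" "x < v" "sin v - sin 0 = (v - 0) * cos x"
      using MVT2[of 0 v sin cos] 3 by (auto intro: DERIV_sin)
    obtain y where y: "v < y" "y < pi / 2" "sin (pi / 2) - sin v = (pi / 2 - v) * cos y"
      using MVT2[of v "pi / 2" sin cos] 3 by (auto intro: DERIV_sin)
    have "cos y \<le> cos x"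
      using x y 3 by (intro cos_monotone_0_pi_le) auto
    then have "(v * (pi / 2 - v)) * cos y \<le> (v * (pi / 2 - v)) * cos x"
      using 3 by (intro mult_left_mono) auto
    moreover have "(v * (pi / 2 - v)) * cos x = (pi / 2 - v) * sin v"
      using x(3) by (simp add: mult.commute)
    moreover have "(v * (pi / 2 - v)) * cos y = v * (1 - sin v)"
      using y(3) by (simp add: mult.commute)
    ultimately show ?thesis
      by (simp add: algebra_simps)
  next
    case 2
    show ?thesis
      unfolding 2 by simp
  qed auto
qed

lemma one_minus_cos_ge:
  fixes u :: real
  assumes "\<bar>u\<bar> \<le> pi"
  shows "2 * u\<^sup>2 \<le> pi\<^sup>2 * (1 - cos u)"
proof -
  have "2 * (\<bar>u\<bar> / 2) \<le> pi * sin (\<bar>u\<bar> / 2)"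
    using assms by (intro sin_ge_chord) auto
  then have "\<bar>u\<bar>\<^sup>2 \<le> (pi * sin (\<bar>u\<bar> / 2))\<^sup>2"
    by (intro power_mono) auto
  moreover have "1 - cos u = 2 * (sin (\<bar>u\<bar> / 2))\<^sup>2"
    using cos_double_sin[of "\<bar>u\<bar> / 2"] by simp
  ultimately show ?thesis
    by (simp add: power_mult_distrib)
qed

lemma pi_pow_bounds: "pi\<^sup>2 \<le> 16" "pi ^ 3 \<le> 64"
  using power_mono[of pi 4 2] power_mono[of pi 4 3] pi_less_4 by auto

text \<open>Clearing denominators avoids the removable singularities in the closed form of \<open>S_k\<close>.\<close>

lemma fund_S_product:
  assumes n: "1 \<le> n" and k: "k \<in> {1..n}"
  defines "h \<equiv> pi / (2 * real n)" and "\<theta> \<equiv> node n k"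
  shows "real n * fund_S n k t * ((cos h - cos (t + \<theta>)) * (cos h - cos (t - \<theta>)))
    = (- 1) ^ k * sin \<theta> * sin (real n * t) * sin t * sin h"
proof -
  have P: "real n * fund_P n k s * (cos s - cos \<theta>) = (- 1) ^ (k + 1) * cos (real n * s) * sin \<theta>" for s
    using fund_quot_cosine_sum[OF n k, of s, folded fund_P_cosine_sum[OF n k]]
    by (simp add: \<theta>_def mult_ac)
  have nh: "real n * h = pi / 2"
    using n by (simp add: h_def)
  \<comment> \<open>The two shifts give opposite signs, so in the average the numerators combine to
    the small difference \<open>cos (t - h) - cos (t + h) = 2 sin t sin h\<close>.\<close>
  have c: "cos (real n * (t - h)) = sin (real n * t)" "cos (real n * (t + h)) = - sin (real n * t)"
    by (simp_all add: right_diff_distrib distrib_left nh cos_add cos_diff)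
  have D: "(cos h - cos (t + \<theta>)) * (cos h - cos (t - \<theta>))
      = (cos (t - h) - cos \<theta>) * (cos (t + h) - cos \<theta>)"
  proof -
    \<comment> \<open>With sines and cosines as independent letters, the claim follows from the
      three Pythagorean relations alone.\<close>
    have "(ch - (ct * cx - st * sx)) * (ch - (ct * cx + st * sx))
        = ((ct * ch + st * sh) - cx) * ((ct * ch - st * sh) - cx)"
      if "st\<^sup>2 + ct\<^sup>2 = 1" "sh\<^sup>2 + ch\<^sup>2 = 1" "sx\<^sup>2 + cx\<^sup>2 = 1" for ch ct cx st sh sx :: real
      using that by algebra
    then show ?thesis
      unfolding cos_add cos_diff by simp
  qed
  have "real n * fund_S n k t * ((cos (t - h) - cos \<theta>) * (cos (t + h) - cos \<theta>))
    = 1 / 2 * ((real n * fund_P n k (t - h) * (cos (t - h) - cos \<theta>)) * (cos (t + h) - cos \<theta>)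
      + (real n * fund_P n k (t + h) * (cos (t + h) - cos \<theta>)) * (cos (t - h) - cos \<theta>))"
    by (simp add: fund_S_def h_def algebra_simps)
  also have "\<dots> = (- 1) ^ k * sin \<theta> * sin (real n * t) * sin t * sin h"
    unfolding P c by (simp add: cos_add cos_diff algebra_simps)
  finally show ?thesis
    unfolding D .
qed

text \<open>With \<open>a\<close>, \<open>b\<close>, \<open>e\<close> as in the proof, the numerator
  factor \<open>sin \<theta> * sin t = (b - a) / 2\<close> is absorbed by the factor
  \<open>b - e\<close> of the denominator, which keeps the bound uniform up to the endpoints. The
  other factor \<open>a - e\<close> is at least a multiple of \<open>(t - \<theta>)^2\<close>, and
  \<open>sin h \<le> h\<close> contributes a further \<open>1 / n\<close>.\<close>

lemma fund_S_far:
  assumes n: "1 \<le> n" and k: "k \<in> {1..n}" and t: "t \<in> {0..pi}"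
    and far: "pi / real n \<le> \<bar>t - node n k\<bar>"
  shows "(real n * (t - node n k))\<^sup>2 * \<bar>fund_S n k t\<bar> \<le> 32"
proof -
  define h where "h = pi / (2 * real n)"
  define \<theta> where "\<theta> = node n k"
  define S where "S = \<bar>fund_S n k t\<bar>"
  have S: "0 \<le> S"
    by (simp add: S_def)
  have h: "0 < h" "h \<le> pi / 2"
    using n by (auto simp: h_def field_simps)
  have \<theta>: "0 < \<theta>" "\<theta> < pi"
    using node_in[OF n k] by (auto simp: \<theta>_def)
  have u: "2 * h \<le> \<bar>t - \<theta>\<bar>" "\<bar>t - \<theta>\<bar> \<le> pi"
    using far t \<theta> n by (auto simp: h_def \<theta>_def)
  define a b e where "a = 1 - cos (t - \<theta>)" and "b = 1 - cos (t + \<theta>)" and "e = 1 - cos h"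
  have sin0: "0 \<le> sin \<theta>" "0 \<le> sin t"
    using \<theta> t by (auto intro: sin_ge_zero)
  have ab: "2 * (sin \<theta> * sin t) = b - a"
    by (simp add: a_def b_def cos_add cos_diff)
  have "a \<le> b"
    using ab sin0 by (smt (verit) mult_nonneg_nonneg)
  \<comment> \<open>The distance to the node is at least \<open>2 h\<close>, and
    \<open>1 - cos (2 h) \<ge> 2 (1 - cos h)\<close>. Hence subtracting \<open>e\<close> leaves at
    least half of \<open>a\<close>, and of \<open>b \<ge> a\<close> as well.\<close>
  have "cos \<bar>t - \<theta>\<bar> \<le> cos (2 * h)"
    using u h by (intro cos_monotone_0_pi_le) auto
  then have "cos (t - \<theta>) \<le> 2 * (cos h)\<^sup>2 - 1"
    by (simp add: cos_double_cos)
  moreover have "(cos h)\<^sup>2 \<le> cos h"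
    using h by (simp add: power2_eq_square mult_left_le cos_ge_zero)
  ultimately have "2 * e \<le> a"
    by (simp add: a_def e_def)
  have a_ge: "2 * (t - \<theta>)\<^sup>2 \<le> pi\<^sup>2 * a"
    unfolding a_def using u by (intro one_minus_cos_ge)
  have "t - \<theta> \<noteq> 0"
    using u h by auto
  then have "0 < 2 * (t - \<theta>)\<^sup>2"
    by simp
  with a_ge have "0 < pi\<^sup>2 * a"
    by linarith
  then have "0 < a"
    by (simp add: zero_less_mult_iff)
  have "real n * S * ((b / 2) * (a / 2)) \<le> real n * S * ((b - e) * (a - e))"
    using \<open>2 * e \<le> a\<close> \<open>a \<le> b\<close> \<open>0 < a\<close> S by (intro mult_left_mono mult_mono) auto
  also have "\<dots> = \<bar>real n * fund_S n k t * ((cos h - cos (t + \<theta>)) * (cos h - cos (t - \<theta>)))\<bar>"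
    using \<open>2 * e \<le> a\<close> \<open>a \<le> b\<close> \<open>0 < a\<close>
    by (simp add: S_def abs_mult a_def b_def e_def)
  also have "\<dots> = (sin \<theta> * sin t) * (\<bar>sin (real n * t)\<bar> * \<bar>sin h\<bar>)"
    unfolding h_def \<theta>_def fund_S_product[OF n k]
    using sin0 by (simp add: abs_mult \<theta>_def)
  also have "\<dots> \<le> (b / 2) * (1 * h)"
    using ab \<open>0 < a\<close> \<open>a \<le> b\<close> sin0 h
    by (intro mult_mono) (auto intro: order_trans[OF abs_sin_x_le_abs_x])
  finally have "(b / 2) * (real n * S * a) \<le> (b / 2) * (2 * h)"
    by (simp add: algebra_simps)
  then have Sa: "real n * S * a \<le> 2 * h"
    using \<open>0 < a\<close> \<open>a \<le> b\<close> by (simp add: mult_le_cancel_left)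
  have "(real n * (t - \<theta>))\<^sup>2 * S = real n * (real n * S) * (2 * (t - \<theta>)\<^sup>2) / 2"
    by (simp add: power2_eq_square algebra_simps)
  also have "\<dots> \<le> real n * (real n * S) * (pi\<^sup>2 * a) / 2"
    using a_ge S by (intro divide_right_mono mult_left_mono) auto
  also have "\<dots> = real n * pi\<^sup>2 * (real n * S * a) / 2"
    by (simp add: algebra_simps)
  also have "\<dots> \<le> real n * pi\<^sup>2 * (2 * h) / 2"
    using Sa by (intro divide_right_mono mult_left_mono) auto
  \<comment> \<open>Since \<open>n h = pi / 2\<close>; the final constant 32 is
    \<open>64 / 2\<close>, from \<open>pi < 4\<close>.\<close>
  also have "\<dots> = pi ^ 3 / 2"
    using n by (simp add: h_def field_simps power2_eq_square power3_eq_cube)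
  finally show ?thesis
    using pi_pow_bounds by (simp add: S_def \<theta>_def)
qed

text \<open>Within distance \<open>pi / n\<close> the uniform bound 2 gives the same 32 as
  \<open>pi^2 \<le> 16\<close>; adding \<open>\<bar>S_k\<bar> \<le> 2\<close> yields
  \<open>34 = 32 + 2\<close>.\<close>

lemma fund_S_decay:
  assumes n: "1 \<le> n" and k: "k \<in> {1..n}" and t: "t \<in> {0..pi}"
  shows "\<bar>fund_S n k t\<bar> \<le> 34 / (1 + (real n * (t - node n k))\<^sup>2)"
proof -
  have "(real n * (t - node n k))\<^sup>2 * \<bar>fund_S n k t\<bar> \<le> 32"
  proof (cases "pi / real n \<le> \<bar>t - node n k\<bar>")
    case False
    then have "real n * \<bar>t - node n k\<bar> \<le> pi"
      using n by (simp add: field_simps)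
    then have "(real n * \<bar>t - node n k\<bar>)\<^sup>2 \<le> pi\<^sup>2"
      by (intro power_mono) auto
    then have "(real n * (t - node n k))\<^sup>2 * \<bar>fund_S n k t\<bar> \<le> 16 * 2"
      using abs_fund_S_le_2[OF n k] pi_pow_bounds
      by (intro mult_mono) (auto simp: power_mult_distrib)
    then show ?thesis by simp
  qed (use fund_S_far assms in blast)
  then have "\<bar>fund_S n k t\<bar> * (1 + (real n * (t - node n k))\<^sup>2) \<le> 34"
    using abs_fund_S_le_2[OF n k, of t] by (simp add: algebra_simps)
  then show ?thesis
    by (subst pos_le_divide_eq) (auto intro: add_pos_nonneg)
qed

section \<open>Sums over nodes compared with increments of antiderivatives\<close>

text \<open>The points \<open>n (t - \<theta>_k)\<close> have spacing \<open>pi\<close>, so sums over the nodes telescope when the summand is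
  compared with the increment of an antiderivative over a window of that length.\<close>

lemma window_difference:
  fixes F F' :: "real \<Rightarrow> real"
  assumes "\<And>x. (F has_real_derivative F' x) (at x)"
  obtains \<xi> where "F (u + pi / 2) - F (u - pi / 2) = pi * F' \<xi>" "1 + \<xi>\<^sup>2 \<le> 9 * (1 + u\<^sup>2)"
proof -
  obtain \<xi> where \<xi>: "u - pi / 2 < \<xi>" "\<xi> < u + pi / 2"
      "F (u + pi / 2) - F (u - pi / 2) = (u + pi / 2 - (u - pi / 2)) * F' \<xi>"
    using MVT2[of "u - pi / 2" "u + pi / 2" F F'] assms by auto
  \<comment> \<open>As \<open>pi / 2 < 2\<close>, moving from \<open>u\<close> to
    \<open>\<xi>\<close> costs at most \<open>1 + 2 * 4 + 2 u^2 \<le> 9 (1 + u^2)\<close>.\<close>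
  have "(\<xi> - u)\<^sup>2 \<le> 4"
    using \<xi> pi_less_4 abs_le_square_iff[of "\<xi> - u" 2] by auto
  moreover have "\<xi>\<^sup>2 \<le> 2 * (\<xi> - u)\<^sup>2 + 2 * u\<^sup>2"
    using sum_squares_bound[of "\<xi> - u" u] zero_le_power2[of "\<xi> - 2 * u"]
    by (simp add: power2_eq_square algebra_simps)
  moreover have "1 + a \<le> 9 * (1 + b)" if "d \<le> 4" "a \<le> 2 * d + 2 * b" "0 \<le> b" for a b d :: real
    using that by simp
  ultimately have "1 + \<xi>\<^sup>2 \<le> 9 * (1 + u\<^sup>2)"
    using zero_le_power2 by blast
  with \<xi>(3) show ?thesis
    by (intro that) auto
qed

text \<open>The bounded range of \<open>arctan\<close> will bound the sum over all windows.\<close>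

lemma arctan_window: "1 / (1 + u\<^sup>2) \<le> 9 / pi * (arctan (u + pi / 2) - arctan (u - pi / 2))"
proof -
  obtain \<xi> where \<xi>: "arctan (u + pi / 2) - arctan (u - pi / 2) = pi * inverse (1 + \<xi>\<^sup>2)"
      "1 + \<xi>\<^sup>2 \<le> 9 * (1 + u\<^sup>2)"
    using window_difference[of arctan "\<lambda>x. inverse (1 + x\<^sup>2)" u] DERIV_arctan by blast
  have "inverse (9 * (1 + u\<^sup>2)) \<le> inverse (1 + \<xi>\<^sup>2)"
    using \<xi>(2) by (intro le_imp_inverse_le) (auto intro: add_pos_nonneg)
  moreover have "1 / y = 9 * inverse (9 * y)" for y :: real
    by (simp add: inverse_eq_divide)
  from this[of "1 + u\<^sup>2"] have "1 / (1 + u\<^sup>2) = 9 * inverse (9 * (1 + u\<^sup>2))" .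
  moreover have "9 / pi * (pi * inverse (1 + \<xi>\<^sup>2)) = 9 * inverse (1 + \<xi>\<^sup>2)"
    by simp
  ultimately show ?thesis
    unfolding \<xi>(1) by linarith
qed

text \<open>For the weighted sums the antiderivative is \<open>arsinh\<close>, whose logarithmic
  growth is the source of \<open>ln n\<close>. The factor 3 is the square root of the 9 in
  \<open>window_difference\<close>.\<close>

lemma arsinh_window:
  "1 / sqrt (1 + u\<^sup>2) \<le> 3 / pi * (arsinh (u + pi / 2) - arsinh (u - pi / 2))" for u :: real
proof -
  obtain \<xi> where \<xi>: "arsinh (u + pi / 2) - arsinh (u - pi / 2) = pi * (1 / sqrt (\<xi>\<^sup>2 + 1))"
      "1 + \<xi>\<^sup>2 \<le> 9 * (1 + u\<^sup>2)"
    using window_difference[of arsinh "\<lambda>x. 1 / sqrt (x\<^sup>2 + 1)" u]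
    by (metis arsinh_real_has_field_derivative)
  have "sqrt (\<xi>\<^sup>2 + 1) \<le> sqrt (9 * (1 + u\<^sup>2))"
    using \<xi>(2) by (simp add: add.commute)
  also have "\<dots> = 3 * sqrt (1 + u\<^sup>2)"
    using real_sqrt_mult[of 9 "1 + u\<^sup>2"] real_sqrt_abs[of 3] by simp
  finally have "inverse (3 * sqrt (1 + u\<^sup>2)) \<le> inverse (sqrt (\<xi>\<^sup>2 + 1))"
    by (intro le_imp_inverse_le) (auto intro: add_nonneg_pos)
  then show ?thesis
    unfolding \<xi>(1) by (simp add: field_simps)
qed

text \<open>The \<open>k\<close>-th window is \<open>[(k - 1) pi - x, k pi - x]\<close>, so
  consecutive increments of \<open>F\<close> telescope.\<close>

lemma sum_window:
  fixes F :: "real \<Rightarrow> real"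
  assumes "\<And>u. f u \<le> c * (F (u + pi / 2) - F (u - pi / 2))"
  shows "(\<Sum>k=1..n. f ((real k - 1 / 2) * pi - x)) \<le> c * (F (real n * pi - x) - F (- x))"
proof (induction n)
  case (Suc n)
  have "f ((real (Suc n) - 1 / 2) * pi - x) \<le> c * (F (real (Suc n) * pi - x) - F (real n * pi - x))"
    using assms[of "(real (Suc n) - 1 / 2) * pi - x"] by (simp add: algebra_simps)
  with Suc show ?case
    by (simp add: algebra_simps)
qed simp

text \<open>Here \<open>y + sqrt (y^2 + 1) \<le> 2 y + 1 \<le> 16 n\<close>, and
  \<open>ln 16 = 4 ln 2 < 3\<close>.\<close>

lemma arsinh_le_log:
  assumes n: "1 \<le> n" and y: "0 \<le> y" "y \<le> real n * pi"
  shows "arsinh y \<le> 3 * (1 + ln (real n))"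
proof -
  have "sqrt (y\<^sup>2 + 1) \<le> y + 1"
    using y by (intro real_le_lsqrt) (auto simp: power2_eq_square algebra_simps)
  moreover have "real n * pi \<le> real n * 4"
    using pi_less_4 by (intro mult_left_mono) auto
  ultimately have "y + sqrt (y\<^sup>2 + 1) \<le> 16 * real n"
    using y n by linarith
  moreover have "0 < y + sqrt (y\<^sup>2 + 1)"
    using y by (intro add_nonneg_pos) (auto intro: add_nonneg_pos)
  ultimately have "arsinh y \<le> ln (16 * real n)"
    unfolding arsinh_real_def by simp
  also have "\<dots> = 4 * ln 2 + ln (real n)"
    using n ln_realpow[of 2 4] by (simp add: ln_mult)
  also have "\<dots> \<le> 3 * (1 + ln (real n))"
    using ln2_le_25_over_36 ln_ge_zero[of "real n"] n by (simp only: distrib_left) linarith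
  finally show ?thesis .
qed

text \<open>The majorant is the derivative of \<open>arsinh\<close>, so that it fits both the window
  comparison and the integral estimate.\<close>

lemma abs_weight_le:
  fixes u :: real
  shows "\<bar>u\<bar> / (1 + u\<^sup>2) \<le> 1 / sqrt (1 + u\<^sup>2)"
proof -
  define s where "s = sqrt (1 + u\<^sup>2)"
  have "\<bar>u\<bar> \<le> s"
    unfolding s_def by (intro real_le_rsqrt) simp
  have "0 < s" and s: "1 + u\<^sup>2 = s * s"
    by (simp_all add: s_def add_pos_nonneg)
  have "\<bar>u\<bar> / (s * s) \<le> s / (s * s)"
    using \<open>\<bar>u\<bar> \<le> s\<close> by (intro divide_right_mono) auto
  also have "\<dots> = 1 / s"
    using \<open>0 < s\<close> by simp
  finally show ?thesis
    unfolding s_def by simp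
qed

section \<open>Sums and integrals of the kernel functions\<close>

context
  fixes n :: nat
  assumes n: "1 \<le> n"
begin

text \<open>Puts the decay bounds into the form summed by \<open>sum_window\<close>, with
  \<open>x = n t\<close>.\<close>

lemma scaled_node_square:
  "(real n * (t - node n k))\<^sup>2 = ((real k - 1 / 2) * pi - real n * t)\<^sup>2"
proof -
  have "real n * (t - node n k) = - ((real k - 1 / 2) * pi - real n * t)"
    using n by (simp add: node_def field_simps)
  then show ?thesis
    by (simp only: power2_minus)
qed

lemma fund_S_weighted_decay:
  assumes k: "k \<in> {1..n}" and t: "t \<in> {0..pi}"
  shows "\<bar>t - node n k\<bar> * \<bar>fund_S n k t\<bar> \<le> 34 / real n * (1 / sqrt (1 + (real n * (t - node n k))\<^sup>2))"
proof -
  define u where "u = real n * (t - node n k)"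
  have e: "\<bar>t - node n k\<bar> = \<bar>u\<bar> / real n"
    using n by (simp add: u_def abs_mult)
  have "\<bar>t - node n k\<bar> * \<bar>fund_S n k t\<bar> \<le> \<bar>u\<bar> / real n * (34 / (1 + u\<^sup>2))"
    unfolding e unfolding u_def by (intro mult_left_mono fund_S_decay n k t) auto
  also have "\<bar>u\<bar> / real n * (34 / (1 + u\<^sup>2)) = 34 / real n * (\<bar>u\<bar> / (1 + u\<^sup>2))"
    by (simp add: mult.commute)
  also have "\<dots> \<le> 34 / real n * (1 / sqrt (1 + u\<^sup>2))"
    by (intro mult_left_mono abs_weight_le) auto
  finally show ?thesis
    by (simp add: u_def)
qed

text \<open>The increment of \<open>arctan\<close> over all windows is at most \<open>pi\<close>,
  whence \<open>306 = 34 * 9\<close>.\<close>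

lemma sum_abs_fund_S:
  assumes t: "t \<in> {0..pi}"
  shows "(\<Sum>k=1..n. \<bar>fund_S n k t\<bar>) \<le> 306"
proof -
  have "(\<Sum>k=1..n. \<bar>fund_S n k t\<bar>) \<le> (\<Sum>k=1..n. 34 * (1 / (1 + ((real k - 1 / 2) * pi - real n * t)\<^sup>2)))"
    using fund_S_decay[OF n _ t] by (intro sum_mono) (simp add: scaled_node_square[symmetric])
  also have "\<dots> \<le> 34 * (9 / pi * (arctan (real n * pi - real n * t) - arctan (- (real n * t))))"
    unfolding sum_distrib_left[symmetric] by (intro mult_left_mono sum_window arctan_window) auto
  also have "\<dots> \<le> 34 * (9 / pi * pi)"
    using arctan_ubound[of "real n * pi - real n * t"] arctan_lbound[of "- (real n * t)"]
    by (intro mult_left_mono) auto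
  finally show ?thesis
    by simp
qed

text \<open>As \<open>arsinh\<close> is odd, its increment over all windows is a sum of two values,
  each at most \<open>3 (1 + ln n)\<close>. With \<open>pi \<ge> 2\<close> the constant is
  \<open>34 * (3 / 2) * 6 = 306\<close>.\<close>

lemma sum_weighted_fund_S:
  assumes t: "t \<in> {0..pi}"
  shows "(\<Sum>k=1..n. \<bar>t - node n k\<bar> * \<bar>fund_S n k t\<bar>) \<le> 306 * (1 + ln (real n)) / real n"
proof -
  have "(\<Sum>k=1..n. \<bar>t - node n k\<bar> * \<bar>fund_S n k t\<bar>)
      \<le> (\<Sum>k=1..n. 34 / real n * (1 / sqrt (1 + ((real k - 1 / 2) * pi - real n * t)\<^sup>2)))"
    using fund_S_weighted_decay[OF _ t] by (intro sum_mono) (simp add: scaled_node_square[symmetric])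
  also have "\<dots> \<le> 34 / real n * (3 / pi * (arsinh (real n * pi - real n * t) - arsinh (- (real n * t))))"
    unfolding sum_distrib_left[symmetric] by (intro mult_left_mono sum_window arsinh_window) auto
  also have "\<dots> \<le> 34 / real n * (3 / pi * (6 * (1 + ln (real n))))"
  proof (intro mult_left_mono)
    have "0 \<le> real n * t" "real n * t \<le> real n * pi"
      using t by (auto intro: mult_left_mono)
    then show "arsinh (real n * pi - real n * t) - arsinh (- (real n * t)) \<le> 6 * (1 + ln (real n))"
      using arsinh_le_log[OF n, of "real n * t"] arsinh_le_log[OF n, of "real n * pi - real n * t"]
      by simp
  qed auto
  also have "\<dots> \<le> 34 / real n * (3 / 2 * (6 * (1 + ln (real n))))"
    using pi_ge_two n by (intro mult_left_mono mult_right_mono divide_left_mono) auto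
  also have "\<dots> = 306 * (1 + ln (real n)) / real n"
    by (simp add: add_divide_distrib)
  finally show ?thesis .
qed

lemma integral_abs_fund_S:
  assumes k: "k \<in> {1..n}"
  shows "(LINT t|leb_0pi. \<bar>fund_S n k t\<bar>) \<le> 306 / real n"
proof -
  define F where "F t = 34 / real n * arctan (real n * (t - node n k))" for t
  have D: "(F has_vector_derivative 34 / (1 + (real n * (t - node n k))\<^sup>2)) (at t within {0..pi})" for t
    unfolding F_def has_real_derivative_iff_has_vector_derivative[symmetric]
    using n by (auto intro!: derivative_eq_intros simp: divide_inverse)
  have I: "integrable leb_0pi (\<lambda>t. 34 / (1 + (real n * (t - node n k))\<^sup>2))"
    by (intro continuous_imp_integrable_real continuous_intros) (auto simp: add_nonneg_eq_0_iff)
  have "(LINT t|leb_0pi. \<bar>fund_S n k t\<bar>) \<le> (LINT t|leb_0pi. 34 / (1 + (real n * (t - node n k))\<^sup>2))"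
    using fund_S_decay[OF n k] by (intro integral_mono'[OF I]) auto
  also have "\<dots> = F pi - F 0"
    using fundamental_theorem_of_calculus[of 0 pi F, OF _ D] I
    by (simp add: lebesgue_integral_eq_integral integral_unique)
  also have "\<dots> = 34 / real n * (arctan (real n * (pi - node n k)) - arctan (real n * (0 - node n k)))"
    by (simp add: F_def right_diff_distrib)
  \<comment> \<open>The increment is below \<open>pi\<close>; rounding up to 9 gives the constant
    306 of \<open>sum_abs_fund_S\<close>.\<close>
  also have "\<dots> \<le> 34 / real n * 9"
    using arctan_ubound[of "real n * (pi - node n k)"] arctan_lbound[of "real n * (0 - node n k)"]
      pi_less_4 by (intro mult_left_mono) auto
  finally show ?thesis
    by simp
qed

lemma integral_weighted_fund_S:
  assumes k: "k \<in> {1..n}"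
  shows "(LINT t|leb_0pi. \<bar>t - node n k\<bar> * \<bar>fund_S n k t\<bar>) \<le> 306 * (1 + ln (real n)) / (real n)\<^sup>2"
proof -
  define F where "F t = 34 / (real n)\<^sup>2 * arsinh (real n * (t - node n k))" for t
  define w where "w t = 34 / real n * (1 / sqrt (1 + (real n * (t - node n k))\<^sup>2))" for t
  have D: "(F has_vector_derivative w t) (at t within {0..pi})" for t
    unfolding F_def w_def has_real_derivative_iff_has_vector_derivative[symmetric]
    using n by (auto intro!: derivative_eq_intros arsinh_real_has_field_derivative[THEN DERIV_chain2]
        simp: power2_eq_square add.commute)
  have pos: "1 + x\<^sup>2 \<noteq> 0" for x :: real
    by (simp add: add_nonneg_eq_0_iff)
  have I: "integrable leb_0pi w"
    unfolding w_def by (intro continuous_imp_integrable_real continuous_intros) (auto simp: pos n)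
  have "(LINT t|leb_0pi. \<bar>t - node n k\<bar> * \<bar>fund_S n k t\<bar>) \<le> (LINT t|leb_0pi. w t)"
    using fund_S_weighted_decay[OF k] by (intro integral_mono'[OF I]) (auto simp: w_def)
  also have "\<dots> = F pi - F 0"
    using fundamental_theorem_of_calculus[of 0 pi F, OF _ D] I
    by (simp add: lebesgue_integral_eq_integral integral_unique)
  also have "\<dots> = 34 / (real n)\<^sup>2 * (arsinh (real n * (pi - node n k)) - arsinh (- (real n * node n k)))"
    by (simp add: F_def right_diff_distrib add_divide_distrib)
  also have "\<dots> \<le> 34 / (real n)\<^sup>2 * (9 * (1 + ln (real n)))"
  proof (intro mult_left_mono)
    have "0 \<le> real n * node n k" "real n * node n k \<le> real n * pi"
      "0 \<le> real n * (pi - node n k)" "real n * (pi - node n k) \<le> real n * pi"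
      using node_in[OF n k] by (auto intro: mult_left_mono)
    then have "arsinh (real n * (pi - node n k)) - arsinh (- (real n * node n k)) \<le> 6 * (1 + ln (real n))"
      using arsinh_le_log[OF n, of "real n * node n k"] arsinh_le_log[OF n, of "real n * (pi - node n k)"]
      by simp
    \<comment> \<open>Again enlarged from 6 to 9 to reach the common constant
      \<open>306 = 34 * 9\<close>.\<close>
    also have "\<dots> \<le> 9 * (1 + ln (real n))"
      using n by simp
    finally show "arsinh (real n * (pi - node n k)) - arsinh (- (real n * node n k))
        \<le> 9 * (1 + ln (real n))" .
  qed simp
  finally show ?thesis
    by (simp add: mult_left_mono mult_right_mono)
qed

end

section \<open>Inequalities for powers and for \<open>L^p\<close> norms\<close>

text \<open>Tangent-line inequality for \<open>a powr p\<close> at the point \<open>c\<close>,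
  scaled by \<open>c powr (1 - p)\<close>. In this form \<open>p = 1\<close> is included and no
  conjugate exponent appears.\<close>

lemma powr_Young:
  fixes a c p :: real
  assumes p: "1 \<le> p" and c: "0 < c" and a: "0 \<le> a"
  shows "p * a \<le> c powr (1 - p) * a powr p + (p - 1) * c"
proof (cases "a = 0")
  case False
  with a have a0: "0 < a"
    by simp
  have "((a / c) powr p) powr (1 / p) * 1 powr (1 - 1 / p) \<le> 1 / p * (a / c) powr p + (1 - 1 / p) * 1"
    using p c a0 by (intro Youngs_inequality_0) auto
  then have "a / c \<le> 1 / p * (a / c) powr p + (1 - 1 / p)"
    using p c a0 by (simp add: powr_powr)
  then have "(p * c) * (a / c) \<le> (p * c) * (1 / p * (a / c) powr p + (1 - 1 / p))"
    using p c by (intro mult_left_mono) auto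
  also have "\<dots> = c * (a / c) powr p + (p - 1) * c"
    using p by (simp add: algebra_simps)
  also have "c * (a / c) powr p = c powr (1 - p) * a powr p"
    using c a0 by (simp add: powr_divide powr_diff)
  finally show ?thesis
    using c by simp
qed (use p c in simp)

text \<open>Comparison with the maximum works for every \<open>q \<ge> 0\<close>, so it serves both
  for the exponent \<open>p\<close> and for \<open>1 / p\<close>.\<close>

lemma add_powr_le:
  fixes a b q :: real
  assumes "0 \<le> q" "0 \<le> a" "0 \<le> b"
  shows "(a + b) powr q \<le> 2 powr q * (a powr q + b powr q)"
proof -
  have "(a + b) powr q \<le> (2 * max a b) powr q"
    using assms by (intro powr_mono2) auto
  also have "\<dots> = 2 powr q * max a b powr q"
    using assms by (simp add: powr_mult)
  also have "\<dots> \<le> 2 powr q * (a powr q + b powr q)"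
    by (intro mult_left_mono) (auto simp: max_def)
  finally show ?thesis .
qed

lemma integrable_const_0pi: "integrable leb_0pi (\<lambda>_. c :: real)"
  by (intro continuous_imp_integrable_real continuous_intros)

lemma continuous_on_imp_Lp_0pi:
  fixes g :: "real \<Rightarrow> real"
  assumes "1 \<le> p" "continuous_on {0..pi} g"
  shows "g \<in> Lp_0pi p"
proof -
  have "integrable leb_0pi (\<lambda>t. \<bar>g t\<bar> powr p)" "integrable leb_0pi g"
    by (intro continuous_imp_integrable_real continuous_on_powr' continuous_intros; use assms in auto)+
  then show ?thesis
    by (auto simp: Lp_0pi_def)
qed

lemma Lp_0pi_integrable_powr: "f \<in> Lp_0pi p \<Longrightarrow> integrable leb_0pi (\<lambda>t. \<bar>f t\<bar> powr p)"
  by (simp add: Lp_0pi_def)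

text \<open>On a finite measure space \<open>L^p\<close> lies in \<open>L^1\<close>:
  \<open>powr_Young\<close> with \<open>c = 1\<close> gives
  \<open>\<bar>f\<bar> \<le> \<bar>f\<bar> powr p + (p - 1)\<close>.\<close>

lemma Lp_0pi_integrable_abs:
  assumes p: "1 \<le> p" and f: "f \<in> Lp_0pi p"
  shows "integrable leb_0pi (\<lambda>t. \<bar>f t\<bar>)"
proof (rule Bochner_Integration.integrable_bound)
  show "integrable leb_0pi (\<lambda>t. \<bar>f t\<bar> powr p + (p - 1))"
    using f by (intro Bochner_Integration.integrable_add integrable_const_0pi Lp_0pi_integrable_powr)
  have "\<bar>f t\<bar> \<le> \<bar>f t\<bar> powr p + (p - 1)" for t
    using powr_Young[of p 1 "\<bar>f t\<bar>"] p mult_right_mono[of 1 p "\<bar>f t\<bar>"] by simp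
  then show "AE t in leb_0pi. norm \<bar>f t\<bar> \<le> norm (\<bar>f t\<bar> powr p + (p - 1))"
    using p by (intro AE_I2) (simp add: abs_of_nonneg)
qed (use f in \<open>auto simp: Lp_0pi_def\<close>)

lemma integrable_abs_sum_powr:
  assumes p: "1 \<le> p" and a: "a \<in> Lp_0pi p" and b: "b \<in> Lp_0pi p"
  shows "integrable leb_0pi (\<lambda>t. 2 powr p * (\<bar>a t\<bar> powr p + \<bar>b t\<bar> powr p))"
  using a b by (intro integrable_mult_right Bochner_Integration.integrable_add Lp_0pi_integrable_powr)

lemma Lp_0pi_dominated:
  assumes p: "1 \<le> p" and a: "a \<in> Lp_0pi p" and b: "b \<in> Lp_0pi p"
    and F: "F \<in> borel_measurable leb_0pi" "\<And>t. t \<in> {0..pi} \<Longrightarrow> \<bar>F t\<bar> \<le> \<bar>a t\<bar> + \<bar>b t\<bar>"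
  shows "F \<in> Lp_0pi p"
proof -
  have "\<bar>F t\<bar> powr p \<le> 2 powr p * (\<bar>a t\<bar> powr p + \<bar>b t\<bar> powr p)" if "t \<in> {0..pi}" for t
    using F(2)[OF that] p by (intro order_trans[OF powr_mono2 add_powr_le]) auto
  then have "integrable leb_0pi (\<lambda>t. \<bar>F t\<bar> powr p)"
    using F(1) by (intro Bochner_Integration.integrable_bound[OF integrable_abs_sum_powr[OF p a b]] AE_I2) auto
  with F(1) show ?thesis
    by (simp add: Lp_0pi_def)
qed

text \<open>A triangle inequality up to a constant, in place of Minkowski's. The 4 is
  \<open>2 * 2\<close>: one factor is the \<open>p\<close>-th root of \<open>2 powr p\<close>, the
  other bounds \<open>2 powr (1 / p)\<close>.\<close>

lemma Lp_norm_dominated: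
  assumes p: "1 \<le> p" and a: "a \<in> Lp_0pi p" and b: "b \<in> Lp_0pi p"
    and F: "\<And>t. t \<in> {0..pi} \<Longrightarrow> \<bar>F t\<bar> \<le> \<bar>a t\<bar> + \<bar>b t\<bar>"
  shows "Lp_norm p F \<le> 4 * (Lp_norm p a + Lp_norm p b)"
proof -
  define A B where "A = (LINT t|leb_0pi. \<bar>a t\<bar> powr p)" and "B = (LINT t|leb_0pi. \<bar>b t\<bar> powr p)"
  have AB: "0 \<le> A" "0 \<le> B"
    by (simp_all add: A_def B_def)
  have "\<bar>F t\<bar> powr p \<le> 2 powr p * (\<bar>a t\<bar> powr p + \<bar>b t\<bar> powr p)" if "t \<in> {0..pi}" for t
    using F[OF that] p by (intro order_trans[OF powr_mono2 add_powr_le]) auto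
  \<comment> \<open>If the left integrand is not integrable, its integral is 0 by convention and the
    nonnegative right-hand side still bounds it.\<close>
  then have "(LINT t|leb_0pi. \<bar>F t\<bar> powr p) \<le> (LINT t|leb_0pi. 2 powr p * (\<bar>a t\<bar> powr p + \<bar>b t\<bar> powr p))"
    by (intro integral_mono'[OF integrable_abs_sum_powr[OF p a b]]) auto
  also have "\<dots> = 2 powr p * (A + B)"
    using a b by (simp add: A_def B_def Lp_0pi_integrable_powr)
  finally have "Lp_norm p F \<le> (2 powr p * (A + B)) powr (1 / p)"
    unfolding Lp_norm_def using p by (intro powr_mono2) auto
  also have "\<dots> = 2 * (A + B) powr (1 / p)"
    using p AB by (simp add: powr_mult powr_powr)
  also have "\<dots> \<le> 2 * (2 powr (1 / p) * (A powr (1 / p) + B powr (1 / p)))"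
    using p AB by (intro mult_left_mono add_powr_le) auto
  also have "\<dots> \<le> 2 * (2 * (A powr (1 / p) + B powr (1 / p)))"
    using p powr_mono[of "1 / p" 1 2] by (intro mult_left_mono mult_right_mono) auto
  finally show ?thesis
    by (simp add: Lp_norm_def A_def B_def)
qed

lemma Lp_norm_const:
  assumes "1 \<le> p" "0 \<le> c"
  shows "Lp_norm p (\<lambda>_. c) \<le> 4 * c"
proof -
  have "Lp_norm p (\<lambda>_. c) = pi powr (1 / p) * c"
    using assms by (simp add: Lp_norm_def powr_mult powr_powr measure_restrict_space)
  also have "\<dots> \<le> pi powr 1 * c"
    using assms pi_ge_two by (intro mult_right_mono powr_mono) auto
  also have "\<dots> \<le> 4 * c"
    using assms pi_less_4 by (intro mult_right_mono) auto
  finally show ?thesis .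
qed

section \<open>The operator on constants, Lipschitz functions and \<open>L^p\<close>\<close>

context
  fixes n :: nat
  assumes n: "1 \<le> n"
begin

lemma integrable_mult_fund_S:
  assumes k: "k \<in> {1..n}" and \<phi>: "integrable leb_0pi \<phi>"
  shows "integrable leb_0pi (\<lambda>t. \<phi> t * fund_S n k t)"
proof (rule Bochner_Integration.integrable_bound)
  show "integrable leb_0pi (\<lambda>t. \<phi> t * 2)"
    using \<phi> by simp
  have "fund_S n k \<in> borel_measurable leb_0pi"
    by (intro borel_measurable_integrable continuous_imp_integrable_real continuous_on_fund_S n k)
  then show "(\<lambda>t. \<phi> t * fund_S n k t) \<in> borel_measurable leb_0pi"
    using borel_measurable_integrable[OF \<phi>] by (intro borel_measurable_times)
  show "AE t in leb_0pi. norm (\<phi> t * fund_S n k t) \<le> norm (\<phi> t * 2)"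
    using abs_fund_S_le_2[OF n k] by (intro AE_I2) (simp add: abs_mult mult_left_mono)
qed

lemma integrable_mult_abs_fund_S:
  assumes k: "k \<in> {1..n}" and \<phi>: "integrable leb_0pi \<phi>"
  shows "integrable leb_0pi (\<lambda>t. \<phi> t * \<bar>fund_S n k t\<bar>)"
proof -
  have "integrable leb_0pi (\<lambda>t. \<bar>\<phi> t * fund_S n k t\<bar>)"
    by (intro integrable_abs integrable_mult_fund_S k \<phi>)
  moreover have "(\<lambda>t. \<phi> t * \<bar>fund_S n k t\<bar>) \<in> borel_measurable leb_0pi"
  proof -
    have "(\<lambda>t. \<bar>fund_S n k t\<bar>) \<in> borel_measurable leb_0pi"
      by (intro borel_measurable_integrable continuous_imp_integrable_real continuous_intros
          continuous_on_fund_S n k)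
    then show ?thesis
      using borel_measurable_integrable[OF \<phi>] by (intro borel_measurable_times)
  qed
  ultimately show ?thesis
    by (rule Bochner_Integration.integrable_bound) (simp add: abs_mult)
qed

lemma grunwald_durrmeyer_diff:
  assumes "integrable leb_0pi f" "integrable leb_0pi g"
  shows "grunwald_durrmeyer n (\<lambda>t. f t - g t) x = grunwald_durrmeyer n f x - grunwald_durrmeyer n g x"
proof -
  have "(LINT t|leb_0pi. (f t - g t) * fund_S n k t)
      = (LINT t|leb_0pi. f t * fund_S n k t) - (LINT t|leb_0pi. g t * fund_S n k t)" if "k \<in> {1..n}" for k
    using assms that by (simp add: left_diff_distrib integrable_mult_fund_S)
  then show ?thesis
    unfolding grunwald_durrmeyer_def
    by (simp add: right_diff_distrib sum_subtractf)
qed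

lemma grunwald_durrmeyer_const: "grunwald_durrmeyer n (\<lambda>_. c) x = c"
proof -
  have "fund_S n k x * (LINT t|leb_0pi. c * fund_S n k t) = (c * (pi / real n)) * fund_S n k x"
    if "k \<in> {1..n}" for k
    using integral_fund_S[OF n that] by simp
  then have "grunwald_durrmeyer n (\<lambda>_. c) x = real n / pi * (c * (pi / real n) * (\<Sum>k=1..n. fund_S n k x))"
    unfolding grunwald_durrmeyer_def sum_distrib_left by simp
  then show ?thesis
    unfolding sum_fund_S[OF n] using n by simp
qed

lemma continuous_on_grunwald_durrmeyer: "continuous_on A (grunwald_durrmeyer n f)"
  unfolding grunwald_durrmeyer_def[abs_def]
  by (intro continuous_intros continuous_on_fund_S n) auto

text \<open>Reproduction of constants moves \<open>g x\<close> inside the operator, and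
  \<open>\<bar>t - x\<bar>\<close> is split at the node. One part pairs the weighted integral with
  the plain sum, the other the plain integral with the weighted sum; together they give
  \<open>2 * 306^2 / pi \<le> 93636\<close>.\<close>

lemma grunwald_durrmeyer_sub_le:
  assumes g: "integrable leb_0pi g" and x: "x \<in> {0..pi}" and G: "0 \<le> G"
    and lip: "\<And>t. t \<in> {0..pi} \<Longrightarrow> \<bar>g t - g x\<bar> \<le> G * \<bar>t - x\<bar>"
  shows "\<bar>grunwald_durrmeyer n g x - g x\<bar> \<le> 93636 * G * (1 + ln (real n)) / real n"
proof -
  define L where "L = 1 + ln (real n)"
  have L: "1 \<le> L"
    using n by (simp add: L_def)
  have I: "\<bar>LINT t|leb_0pi. (g t - g x) * fund_S n k t\<bar>
      \<le> G * (306 * L / (real n)\<^sup>2 + \<bar>x - node n k\<bar> * (306 / real n))" if k: "k \<in> {1..n}" for k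
  proof -
    define w where "w t = \<bar>t - node n k\<bar> * \<bar>fund_S n k t\<bar>" for t
    have w_nonneg: "0 \<le> w t" for t
      by (simp add: w_def)
    have int: "integrable leb_0pi w" "integrable leb_0pi (\<lambda>t. \<bar>fund_S n k t\<bar>)"
      unfolding w_def
      by (intro continuous_imp_integrable_real continuous_intros continuous_on_fund_S n k)+
    have "\<bar>LINT t|leb_0pi. (g t - g x) * fund_S n k t\<bar> \<le> (LINT t|leb_0pi. \<bar>(g t - g x) * fund_S n k t\<bar>)"
      by (rule integral_abs_bound)
    also have "\<dots> \<le> (LINT t|leb_0pi. G * (w t + \<bar>x - node n k\<bar> * \<bar>fund_S n k t\<bar>))"
    proof (rule integral_mono')
      fix t assume "t \<in> space leb_0pi"
      then have "\<bar>g t - g x\<bar> \<le> G * \<bar>t - x\<bar>"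
        using lip by simp
      also have "\<dots> \<le> G * (\<bar>t - node n k\<bar> + \<bar>x - node n k\<bar>)"
        using G by (intro mult_left_mono) auto
      finally have "\<bar>g t - g x\<bar> * \<bar>fund_S n k t\<bar> \<le> G * (\<bar>t - node n k\<bar> + \<bar>x - node n k\<bar>) * \<bar>fund_S n k t\<bar>"
        by (intro mult_right_mono) auto
      then show "\<bar>(g t - g x) * fund_S n k t\<bar> \<le> G * (w t + \<bar>x - node n k\<bar> * \<bar>fund_S n k t\<bar>)"
        unfolding abs_mult w_def by (simp add: algebra_simps)
    qed (use int G in \<open>auto simp: w_nonneg\<close>)
    also have "\<dots> = G * ((LINT t|leb_0pi. w t) + \<bar>x - node n k\<bar> * (LINT t|leb_0pi. \<bar>fund_S n k t\<bar>))"
      using int by simp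
    also have "\<dots> \<le> G * (306 * L / (real n)\<^sup>2 + \<bar>x - node n k\<bar> * (306 / real n))"
      using integral_weighted_fund_S[OF n k] integral_abs_fund_S[OF n k] G
      by (intro mult_left_mono add_mono) (auto simp: w_def L_def)
    finally show ?thesis .
  qed
  have "grunwald_durrmeyer n g x - g x = grunwald_durrmeyer n (\<lambda>t. g t - g x) x"
    using grunwald_durrmeyer_diff[OF g integrable_const_0pi[of "g x"]] grunwald_durrmeyer_const by simp
  also have "\<bar>\<dots>\<bar> = real n / pi * \<bar>\<Sum>k=1..n. fund_S n k x * (LINT t|leb_0pi. (g t - g x) * fund_S n k t)\<bar>"
    by (simp add: grunwald_durrmeyer_def abs_mult)
  also have "\<dots> \<le> real n / pi * (\<Sum>k=1..n. \<bar>fund_S n k x\<bar> *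
      (G * (306 * L / (real n)\<^sup>2 + \<bar>x - node n k\<bar> * (306 / real n))))"
    using I by (intro mult_left_mono order_trans[OF sum_abs] sum_mono) (auto simp: abs_mult intro!: mult_left_mono)
  also have "\<dots> = real n / pi * (G * (306 * L / (real n)\<^sup>2 * (\<Sum>k=1..n. \<bar>fund_S n k x\<bar>)
      + 306 / real n * (\<Sum>k=1..n. \<bar>x - node n k\<bar> * \<bar>fund_S n k x\<bar>)))"
    by (simp only: sum_distrib_left sum.distrib[symmetric]) (simp add: algebra_simps)
  also have "\<dots> \<le> real n / pi * (G * (306 * L / (real n)\<^sup>2 * 306 + 306 / real n * (306 * L / real n)))"
    using sum_abs_fund_S[OF n x] sum_weighted_fund_S[OF n x] G L
    by (intro mult_left_mono add_mono) (auto simp: L_def)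
  also have "\<dots> = 93636 * (2 / pi) * (G * L / real n)"
    using n by (simp add: field_simps power2_eq_square)
  also have "\<dots> \<le> 93636 * 1 * (G * L / real n)"
    using pi_ge_two G L by (intro mult_right_mono mult_left_mono) auto
  finally show ?thesis
    by (simp add: L_def)
qed

text \<open>Jensen's inequality for a kernel of mass at most \<open>93636 = 306 ^ 2\<close>: Young's inequality is linear in
  \<open>\<bar>f\<bar>\<close>, and its parameter \<open>c\<close> is chosen so that the constant term absorbs \<open>(p - 1) N\<close>.\<close>

lemma abs_grunwald_durrmeyer_powr_le:
  assumes p: "1 \<le> p" and f: "f \<in> Lp_0pi p" and x: "x \<in> {0..pi}"
  shows "\<bar>grunwald_durrmeyer n f x\<bar> powr p \<le> 93636 powr (p - 1) *
    (real n / pi * (\<Sum>k=1..n. \<bar>fund_S n k x\<bar> * (LINT t|leb_0pi. \<bar>f t\<bar> powr p * \<bar>fund_S n k t\<bar>)))"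
proof -
  \<comment> \<open>Replacing \<open>S_k\<close> by its absolute value in both places gives a
    positive linear majorant of the operator.\<close>
  define \<Psi> where
    "\<Psi> \<phi> = real n / pi * (\<Sum>k=1..n. \<bar>fund_S n k x\<bar> * (LINT t|leb_0pi. \<phi> t * \<bar>fund_S n k t\<bar>))"
    for \<phi> :: "real \<Rightarrow> real"
  define N where "N = \<bar>grunwald_durrmeyer n f x\<bar>"
  define c where "c = N / 93636"
  note int_f = Lp_0pi_integrable_abs[OF p f] Lp_0pi_integrable_powr[OF f]
  have \<Psi>_mono: "\<Psi> \<phi> \<le> \<Psi> \<psi>"
    if "integrable leb_0pi \<phi>" "integrable leb_0pi \<psi>" "\<And>t. t \<in> {0..pi} \<Longrightarrow> \<phi> t \<le> \<psi> t" for \<phi> \<psi>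
    unfolding \<Psi>_def using that
    by (intro mult_left_mono sum_mono integral_mono integrable_mult_abs_fund_S mult_right_mono) auto
  have \<Psi>_lin: "\<Psi> (\<lambda>t. a * \<phi> t + b) = a * \<Psi> \<phi> + b * \<Psi> (\<lambda>_. 1)"
    if \<phi>: "integrable leb_0pi \<phi>" for \<phi> a b
  proof -
    have "(LINT t|leb_0pi. (a * \<phi> t + b) * \<bar>fund_S n k t\<bar>)
        = a * (LINT t|leb_0pi. \<phi> t * \<bar>fund_S n k t\<bar>) + b * (LINT t|leb_0pi. 1 * \<bar>fund_S n k t\<bar>)"
      if k: "k \<in> {1..n}" for k
      using integrable_mult_abs_fund_S[OF k \<phi>] integrable_mult_abs_fund_S[OF k integrable_const_0pi[of 1]]
      by (simp add: distrib_right mult.assoc)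
    then show ?thesis
      unfolding \<Psi>_def by (simp add: sum.distrib distrib_left sum_distrib_left mult_ac)
  qed
  have \<Psi>_1: "\<Psi> (\<lambda>_. 1) \<le> 93636"
  proof -
    have "\<Psi> (\<lambda>_. 1) \<le> real n / pi * (\<Sum>k=1..n. \<bar>fund_S n k x\<bar> * (306 / real n))"
      unfolding \<Psi>_def using integral_abs_fund_S[OF n] by (intro mult_left_mono sum_mono) auto
    also have "\<dots> \<le> real n / pi * (306 * (306 / real n))"
      unfolding sum_distrib_right[symmetric] using sum_abs_fund_S[OF n x]
      by (intro mult_left_mono mult_right_mono) auto
    also have "\<dots> = 93636 / pi"
      using n by simp
    also have "\<dots> \<le> 93636 / 1"
      using pi_ge_two by (intro divide_left_mono) auto
    finally show ?thesis
      by simp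
  qed
  have N_le: "N \<le> \<Psi> (\<lambda>t. \<bar>f t\<bar>)"
  proof -
    have "\<bar>LINT t|leb_0pi. f t * fund_S n k t\<bar> \<le> (LINT t|leb_0pi. \<bar>f t\<bar> * \<bar>fund_S n k t\<bar>)" for k
      using integral_abs_bound[of leb_0pi "\<lambda>t. f t * fund_S n k t"] by (simp add: abs_mult)
    then have "\<bar>\<Sum>k=1..n. fund_S n k x * (LINT t|leb_0pi. f t * fund_S n k t)\<bar>
        \<le> (\<Sum>k=1..n. \<bar>fund_S n k x\<bar> * (LINT t|leb_0pi. \<bar>f t\<bar> * \<bar>fund_S n k t\<bar>))"
      by (intro order_trans[OF sum_abs] sum_mono) (auto simp: abs_mult intro!: mult_left_mono)
    then have "real n / pi * \<bar>\<Sum>k=1..n. fund_S n k x * (LINT t|leb_0pi. f t * fund_S n k t)\<bar>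
        \<le> \<Psi> (\<lambda>t. \<bar>f t\<bar>)"
      unfolding \<Psi>_def by (intro mult_left_mono) auto
    then show ?thesis
      by (simp add: N_def grunwald_durrmeyer_def abs_mult)
  qed
  have "N powr p \<le> 93636 powr (p - 1) * \<Psi> (\<lambda>t. \<bar>f t\<bar> powr p)"
  proof (cases "N = 0")
    case True
    have "0 \<le> \<Psi> (\<lambda>t. \<bar>f t\<bar> powr p)"
      unfolding \<Psi>_def by (intro mult_nonneg_nonneg sum_nonneg integral_nonneg_AE) auto
    with True show ?thesis
      by simp
  next
    case False
    then have N: "0 < N" and c: "0 < c"
      by (auto simp: N_def c_def)
    \<comment> \<open>The zero summand matches the affine form of \<open>\<Psi>_lin\<close>.\<close>
    have "p * N \<le> p * \<Psi> (\<lambda>t. \<bar>f t\<bar>) + 0 * \<Psi> (\<lambda>_. 1)"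
      using N_le p by simp
    also have "\<dots> = \<Psi> (\<lambda>t. p * \<bar>f t\<bar> + 0)"
      by (rule \<Psi>_lin[symmetric, OF int_f(1)])
    also have "\<dots> \<le> \<Psi> (\<lambda>t. c powr (1 - p) * \<bar>f t\<bar> powr p + (p - 1) * c)"
      using powr_Young[OF p c] int_f
      by (intro \<Psi>_mono Bochner_Integration.integrable_add integrable_mult_right integrable_const_0pi) auto
    also have "\<dots> = c powr (1 - p) * \<Psi> (\<lambda>t. \<bar>f t\<bar> powr p) + (p - 1) * c * \<Psi> (\<lambda>_. 1)"
      by (rule \<Psi>_lin[OF int_f(2)])
    also have "\<dots> \<le> c powr (1 - p) * \<Psi> (\<lambda>t. \<bar>f t\<bar> powr p) + (p - 1) * c * 93636"
      using \<Psi>_1 p c by (intro add_left_mono mult_left_mono) auto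
    also have "(p - 1) * c * 93636 = p * N - N"
      by (simp add: c_def left_diff_distrib)
    finally have "N \<le> c powr (1 - p) * \<Psi> (\<lambda>t. \<bar>f t\<bar> powr p)"
      by simp
    then have "c powr (p - 1) * N \<le> c powr (p - 1) * (c powr (1 - p) * \<Psi> (\<lambda>t. \<bar>f t\<bar> powr p))"
      by (intro mult_left_mono) auto
    also have "\<dots> = \<Psi> (\<lambda>t. \<bar>f t\<bar> powr p)"
      using c by (simp add: mult.assoc[symmetric] powr_add[symmetric])
    finally have "93636 powr (p - 1) * (c powr (p - 1) * N) \<le> 93636 powr (p - 1) * \<Psi> (\<lambda>t. \<bar>f t\<bar> powr p)"
      by (intro mult_left_mono) auto
    moreover have "93636 powr (p - 1) * (c powr (p - 1) * N) = N powr p"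
      using N by (simp add: c_def powr_divide powr_diff)
    ultimately show ?thesis
      by simp
  qed
  then show ?thesis
    by (simp add: N_def \<Psi>_def)
qed

text \<open>Integrating the pointwise bound over \<open>x\<close> replaces each
  \<open>\<bar>S_k(x)\<bar>\<close> by at most \<open>306 / n\<close>. The sum over \<open>k\<close>
  then moves under the integral over \<open>t\<close>, where it is at most 306. The resulting
  \<open>93636 powr p\<close> has a \<open>p\<close>-th root independent of
  \<open>p\<close>.\<close>

lemma Lp_norm_grunwald_durrmeyer_le:
  assumes p: "1 \<le> p" and f: "f \<in> Lp_0pi p"
  shows "Lp_norm p (grunwald_durrmeyer n f) \<le> 93636 * Lp_norm p f"
proof -
  define A where "A = (LINT t|leb_0pi. \<bar>f t\<bar> powr p)"
  define J where "J k = (LINT t|leb_0pi. \<bar>f t\<bar> powr p * \<bar>fund_S n k t\<bar>)" for k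
  note int_f = Lp_0pi_integrable_powr[OF f]
  have A: "0 \<le> A" and J: "0 \<le> J k" for k
    by (simp_all add: A_def J_def)
  have int_S: "integrable leb_0pi (\<lambda>x. \<bar>fund_S n k x\<bar>)" if "k \<in> {1..n}" for k
    using that by (intro continuous_imp_integrable_real continuous_intros continuous_on_fund_S n)
  have "(LINT x|leb_0pi. \<bar>grunwald_durrmeyer n f x\<bar> powr p)
      \<le> (LINT x|leb_0pi. 93636 powr (p - 1) * (real n / pi * (\<Sum>k=1..n. \<bar>fund_S n k x\<bar> * J k)))"
  proof (rule integral_mono')
    show "\<bar>grunwald_durrmeyer n f x\<bar> powr p
        \<le> 93636 powr (p - 1) * (real n / pi * (\<Sum>k=1..n. \<bar>fund_S n k x\<bar> * J k))"
      if "x \<in> space leb_0pi" for x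
      using abs_grunwald_durrmeyer_powr_le[OF p f] that by (simp add: J_def)
    show "0 \<le> 93636 powr (p - 1) * (real n / pi * (\<Sum>k=1..n. \<bar>fund_S n k x\<bar> * J k))" for x
      using J by (intro mult_nonneg_nonneg sum_nonneg) auto
  qed (use int_S in \<open>intro integrable_mult_right Bochner_Integration.integrable_sum integrable_mult_left\<close>)
  also have "\<dots> = 93636 powr (p - 1) * (real n / pi * (\<Sum>k=1..n. (LINT x|leb_0pi. \<bar>fund_S n k x\<bar>) * J k))"
    using int_S by (simp add: Bochner_Integration.integral_sum)
  also have "\<dots> \<le> 93636 powr (p - 1) * (real n / pi * (\<Sum>k=1..n. 306 / real n * J k))"
    using integral_abs_fund_S[OF n] J by (intro mult_left_mono sum_mono mult_right_mono) auto
  also have "\<dots> = 93636 powr (p - 1) * (306 / pi) * (\<Sum>k=1..n. J k)"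
    unfolding sum_distrib_left[symmetric] using n by simp
  also have "(\<Sum>k=1..n. J k) = (LINT t|leb_0pi. \<bar>f t\<bar> powr p * (\<Sum>k=1..n. \<bar>fund_S n k t\<bar>))"
    unfolding J_def sum_distrib_left using int_f
    by (intro Bochner_Integration.integral_sum[symmetric] integrable_mult_abs_fund_S)
  also have "93636 powr (p - 1) * (306 / pi) * \<dots> \<le> 93636 powr (p - 1) * (306 / pi) * (A * 306)"
  proof (intro mult_left_mono)
    have "(LINT t|leb_0pi. \<bar>f t\<bar> powr p * (\<Sum>k=1..n. \<bar>fund_S n k t\<bar>)) \<le> (LINT t|leb_0pi. \<bar>f t\<bar> powr p * 306)"
      using sum_abs_fund_S[OF n] int_f by (intro integral_mono' mult_left_mono) auto
    then show "(LINT t|leb_0pi. \<bar>f t\<bar> powr p * (\<Sum>k=1..n. \<bar>fund_S n k t\<bar>)) \<le> A * 306"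
      by (simp add: A_def)
  qed auto
  also have "\<dots> = 93636 powr p * A * (1 / pi)"
    by (simp add: powr_diff)
  also have "\<dots> \<le> 93636 powr p * A * 1"
    using pi_ge_two A by (intro mult_left_mono) auto
  finally have "Lp_norm p (grunwald_durrmeyer n f) \<le> (93636 powr p * A) powr (1 / p)"
    unfolding Lp_norm_def using p by (intro powr_mono2) auto
  also have "\<dots> = 93636 * Lp_norm p f"
    using p A by (simp add: Lp_norm_def powr_mult powr_powr A_def)
  finally show ?thesis .
qed

section \<open>Passage to the K-functional\<close>

lemma grunwald_durrmeyer_error_le:
  assumes p: "1 \<le> p" and f: "f \<in> Lp_0pi p" and g: "C1_0pi_deriv g g'"
  shows "Lp_norm p (\<lambda>x. grunwald_durrmeyer n f x - f x)
    \<le> 5992704 * (Lp_norm p (\<lambda>t. f t - g t) + rate_m p n * sup_norm_0pi g')"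
proof -
  define G where "G = sup_norm_0pi g'"
  define w where "w t = f t - g t" for t
  define B where "B = 93636 * G * (1 + ln (real n)) / real n"
  have deriv: "(g has_real_derivative g' t) (at t within {0..pi})" if "t \<in> {0..pi}" for t
    using g that by (simp add: C1_0pi_deriv_def)
  then have cont_g: "continuous_on {0..pi} g"
    by (intro DERIV_continuous_on)
  have "continuous_on {0..pi} (\<lambda>t. \<bar>g' t\<bar>)"
    using g by (intro continuous_intros) (simp add: C1_0pi_deriv_def)
  then have "bdd_above ((\<lambda>t. \<bar>g' t\<bar>) ` {0..pi})"
    by (intro bounded_imp_bdd_above compact_imp_bounded compact_continuous_image) auto
  then have G_ge: "\<bar>g' t\<bar> \<le> G" if "t \<in> {0..pi}" for t
    unfolding G_def sup_norm_0pi_def using that by (intro cSUP_upper)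
  have G: "0 \<le> G"
    using G_ge[of 0] by force
  have B: "0 \<le> B"
    using G n by (simp add: B_def)
  have g_Lp: "g \<in> Lp_0pi p"
    by (rule continuous_on_imp_Lp_0pi[OF p cont_g])
  have w_Lp: "w \<in> Lp_0pi p"
    using f g_Lp by (intro Lp_0pi_dominated[OF p f g_Lp]) (auto simp: w_def[abs_def] Lp_0pi_def)
  have int_g: "integrable leb_0pi g"
    by (intro continuous_imp_integrable_real cont_g)
  have int_f: "integrable leb_0pi f"
    using Lp_0pi_integrable_abs[OF p f] f by (simp add: Lp_0pi_def integrable_abs_iff)
  \<comment> \<open>By the mean value inequality on the convex set \<open>[0, pi]\<close>,
    \<open>G\<close> is a Lipschitz constant of \<open>g\<close>.\<close>
  have g_err: "\<bar>grunwald_durrmeyer n g x - g x\<bar> \<le> B" if x: "x \<in> {0..pi}" for x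
    unfolding B_def
    using field_differentiable_bound[OF _ deriv, of G _ x] x G_ge
    by (intro grunwald_durrmeyer_sub_le[OF int_g x G]) auto
  have Dw: "grunwald_durrmeyer n w \<in> Lp_0pi p"
    by (intro continuous_on_imp_Lp_0pi[OF p] continuous_on_grunwald_durrmeyer)
  have const: "(\<lambda>_. B) \<in> Lp_0pi p"
    by (intro continuous_on_imp_Lp_0pi[OF p] continuous_intros)
  have wB: "(\<lambda>t. \<bar>w t\<bar> + B) \<in> Lp_0pi p"
    using w_Lp B by (intro Lp_0pi_dominated[OF p w_Lp const]) (auto simp: Lp_0pi_def)
  have "grunwald_durrmeyer n f x - f x
      = grunwald_durrmeyer n w x - w x + (grunwald_durrmeyer n g x - g x)" for x
    using grunwald_durrmeyer_diff[OF int_f int_g] by (simp add: w_def[abs_def])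
  then have "Lp_norm p (\<lambda>x. grunwald_durrmeyer n f x - f x)
      \<le> 4 * (Lp_norm p (grunwald_durrmeyer n w) + Lp_norm p (\<lambda>t. \<bar>w t\<bar> + B))"
    using g_err B by (intro Lp_norm_dominated[OF p Dw wB]) (smt (verit))
  also have "\<dots> \<le> 4 * (93636 * Lp_norm p w + 4 * (Lp_norm p w + 4 * B))"
    using B Lp_norm_const[OF p B] Lp_norm_dominated[OF p w_Lp const, of "\<lambda>t. \<bar>w t\<bar> + B"]
    by (intro mult_left_mono add_mono Lp_norm_grunwald_durrmeyer_le p w_Lp) auto
  \<comment> \<open>The term \<open>64 B\<close> determines the constant
    \<open>5992704 = 64 * 93636\<close>; the coefficient \<open>4 * 93636 + 16\<close> of
    \<open>Lp_norm p w\<close> is smaller.\<close>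
  also have "\<dots> \<le> 5992704 * (Lp_norm p w + (1 + ln (real n)) / real n * G)"
  proof -
    have "0 \<le> Lp_norm p w"
      by (simp add: Lp_norm_def)
    moreover have "B = 93636 * ((1 + ln (real n)) / real n * G)"
      by (simp add: B_def)
    ultimately show ?thesis
      unfolding distrib_left[of 5992704] by simp
  qed
  also have "\<dots> \<le> 5992704 * (Lp_norm p w + rate_m p n * G)"
    using G by (intro mult_left_mono add_left_mono mult_right_mono) (auto simp: rate_m_def)
  finally show ?thesis
    by (simp add: w_def[abs_def] G_def)
qed

end

theorem theorem4p8:
  fixes p :: real
  assumes "1 \<le> p"
  shows "\<exists>R Rt :: real. R > 0 \<and> Rt > 0 \<and>
    (\<forall>f \<in> Lp_0pi p. \<forall>n::nat. n \<ge> 1 \<longrightarrow>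
      Lp_norm p (\<lambda>\<theta>. grunwald_durrmeyer n f \<theta> - f \<theta>)
        \<le> R * K_functional p f (Rt * rate_m p n))"
proof (rule exI[of _ 5992704], rule exI[of _ 1], intro conjI ballI allI impI)
  fix f and n :: nat
  assume f: "f \<in> Lp_0pi p" and n: "n \<ge> 1"
  let ?E = "Lp_norm p (\<lambda>\<theta>. grunwald_durrmeyer n f \<theta> - f \<theta>)"
  \<comment> \<open>Since the constant is the same for all \<open>g\<close>, the quotient is a lower
    bound of the set whose infimum is the K-functional.\<close>
  have "?E / 5992704 \<le> K_functional p f (1 * rate_m p n)"
    unfolding K_functional_def
  proof (rule cInf_greatest)
    have "C1_0pi_deriv (\<lambda>_. 0) (\<lambda>_. 0)"
      by (simp add: C1_0pi_deriv_def)
    then show "{Lp_norm p (\<lambda>t. f t - g t) + 1 * rate_m p n * sup_norm_0pi g' |g g'.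
        C1_0pi_deriv g g'} \<noteq> {}"
      by blast
  qed (use grunwald_durrmeyer_error_le[OF n assms f] in \<open>auto simp: field_simps\<close>)
  then show "?E \<le> 5992704 * K_functional p f (1 * rate_m p n)"
    by (simp add: field_simps)
qed auto

end
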